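(* Let $P=(p(x,y))_{x,y\in\Omega}$ be a reversible Markov kernel on a finite state space $\Omega$ with $|\Omega|\ge 2$, and assume $p_*:=\min_{x,y\in\Omega}p(x,y)>0$. Then there exist constants $0<c_-(P)\le c_+(P)<\infty$, depending only on $P$, such that for every integer $n\ge 2$, $$\frac{c_-(P)}{n}\le\operatorname{Gap}(\widetilde P_n)\le\frac{c_+(P)}{n},$$ where $\widetilde P_n$ is the resampled sliding-window count kernel of window length $n$ associated with $P$. In particular, $\operatorname{Gap}(\widetilde P_n)=\Theta_P(n^{-1})$.
   Context: Let $\pi$ be the (unique) stationary distribution of $P$; reversibility means $\pi(x)p(x,y)=\pi(y)p(y,x)$ for all $x,y$. Path law: for $u=(u_1,\dots,u_n)\in\Omega^n$, $\mu_n(u)=\pi(u_1)\prod_{i=1}^{n-1}p(u_i,u_{i+1})$. Counts: $N(u)=(N_x(u))_{x\in\Omega}$ with $N_x(u)=\#\{1\le i\le n:u_i=x\}$; $\Omega_n^{\#}=\{\eta\in\mathbb N^{\Omega}:\sum_x\eta_x=n\}$ (with $0\in\mathbb N$). The count law is $\widetilde\mu_n(\eta)=\sum_{u:N(u)=\eta}\mu_n(u)$; since $p_*>0$, it is strictly positive on $\Omega_n^{\#}$. Let $e_x$ denote the unit vector at coordinate $x$ in $\mathbb N^\Omega$. Count kernel on $\Omega_n^{\#}$: $$\widetilde P_n(\eta,\xi)=\frac1{\widetilde\mu_n(\eta)}\sum_{u\in\Omega^n:\,N(u)=\eta}\mu_n(u)\sum_{z\in\Omega}p(u_n,z)\,\mathbf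 1_{\{\eta-e_{u_1}+e_z=\xi\}} .$$ It is reversible with respect to $\widetilde\mu_n$. Spectral gap: for a Markov kernel $K$ on a finite set $S$ reversible with respect to a probability measure $\rho$, $\mathcal E_K(f,f)=\frac12\sum_{x,y\in S}\rho(x)K(x,y)(f(y)-f(x))^2$, $\operatorname{Var}_\rho(f)$ is the variance of $f$ under $\rho$, and $\operatorname{Gap}(K)=\inf\{\mathcal E_K(f,f)/\operatorname{Var}_\rho(f): f:S\to\mathbb R,\ \operatorname{Var}_\rho(f)>0\}$. *)

theory Defs
  imports "HOL-Analysis.Analysis" "HOL-Library.Landau_Symbols"
begin

text \<open>Markov kernels on a finite state space, given by the type \<open>'a\<close>.\<close>

definition markov_kernel :: "('a::finite \<Rightarrow> 'a \<Rightarrow> real) \<Rightarrow> bool" where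
  "markov_kernel p \<longleftrightarrow> (\<forall>x y. 0 \<le> p x y) \<and> (\<forall>x. (\<Sum>y\<in>UNIV. p x y) = 1)"

definition stationary :: "('a::finite \<Rightarrow> 'a \<Rightarrow> real) \<Rightarrow> ('a \<Rightarrow> real) \<Rightarrow> bool" where
  "stationary p \<pi> \<longleftrightarrow> (\<forall>x. 0 \<le> \<pi> x) \<and> (\<Sum>x\<in>UNIV. \<pi> x) = 1 \<and>
     (\<forall>y. (\<Sum>x\<in>UNIV. \<pi> x * p x y) = \<pi> y)"

definition reversible :: "('a::finite \<Rightarrow> 'a \<Rightarrow> real) \<Rightarrow> ('a \<Rightarrow> real) \<Rightarrow> bool" where
  "reversible p \<pi> \<longleftrightarrow> (\<forall>x y. \<pi> x * p x y = \<pi> y * p y x)"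

definition p_star :: "('a::finite \<Rightarrow> 'a \<Rightarrow> real) \<Rightarrow> real" where
  "p_star p = Min (range (\<lambda>(x, y). p x y))"

lemma p_star_le: "p_star p \<le> p x y"
proof -
  have "p x y \<in> range (\<lambda>(x, y). p x y)"
    by (rule image_eqI[of _ _ "(x, y)"]) auto
  then show ?thesis
    unfolding p_star_def by (intro Min_le) auto
qed

text \<open>The stationary distribution is determined by the kernel, so that a quantity depending
  on both depends on the kernel only.\<close>

lemma stationary_unique:
  assumes p: "markov_kernel p" and pos: "0 < p_star p"
    and \<pi>: "stationary p \<pi>" and \<rho>: "stationary p \<rho>"
  shows "\<pi> = \<rho>"
proof -
  define d where "d x = \<pi> x - \<rho> x" for x
  define c where "c = p_star p"
  have sum_d: "(\<Sum>x\<in>UNIV. d x) = 0"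
    using \<pi> \<rho> by (simp add: d_def stationary_def sum_subtractf)
  have inv: "(\<Sum>x\<in>UNIV. d x * (p x y - c)) = d y" for y
  proof -
    have "(\<Sum>x\<in>UNIV. d x * (p x y - c)) = (\<Sum>x\<in>UNIV. d x * p x y) - (\<Sum>x\<in>UNIV. d x) * c"
      by (simp add: right_diff_distrib sum_subtractf sum_distrib_right)
    also have "\<dots> = d y"
      using \<pi> \<rho> by (simp add: sum_d) (simp add: d_def stationary_def left_diff_distrib sum_subtractf)
    finally show ?thesis .
  qed
  have nonneg: "0 \<le> p x y - c" for x y
    using p_star_le[of p x y] by (simp add: c_def)
  have le: "\<bar>d y\<bar> \<le> (\<Sum>x\<in>UNIV. \<bar>d x\<bar> * (p x y - c))" for y
  proof -
    have "\<bar>d y\<bar> \<le> (\<Sum>x\<in>UNIV. \<bar>d x * (p x y - c)\<bar>)"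
      using sum_abs[of "\<lambda>x. d x * (p x y - c)" UNIV] by (simp only: inv)
    also have "\<dots> = (\<Sum>x\<in>UNIV. \<bar>d x\<bar> * (p x y - c))"
      by (intro sum.cong refl) (simp only: abs_mult abs_of_nonneg[OF nonneg])
    finally show ?thesis .
  qed
  have "(\<Sum>y\<in>UNIV. \<bar>d y\<bar>) \<le> (\<Sum>y\<in>UNIV. \<Sum>x\<in>UNIV. \<bar>d x\<bar> * (p x y - c))"
    by (intro sum_mono le)
  also have "\<dots> = (\<Sum>x\<in>UNIV. \<bar>d x\<bar> * (\<Sum>y\<in>UNIV. p x y - c))"
    by (subst sum.swap) (simp add: sum_distrib_left)
  also have "\<dots> = (\<Sum>x\<in>UNIV. \<bar>d x\<bar>) * (1 - of_nat (card (UNIV :: 'a set)) * c)"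
    using p by (simp add: markov_kernel_def sum_subtractf sum_distrib_right)
  finally have "(\<Sum>x\<in>UNIV. \<bar>d x\<bar>) * (of_nat (card (UNIV :: 'a set)) * c) \<le> 0"
    by (simp add: algebra_simps)
  moreover have "0 < of_nat (card (UNIV :: 'a set)) * c"
    using pos by (simp add: c_def)
  ultimately have "(\<Sum>x\<in>UNIV. \<bar>d x\<bar>) \<le> 0"
    by (metis mult_le_0_iff not_le)
  then have "(\<Sum>x\<in>UNIV. \<bar>d x\<bar>) = 0"
    by (intro order.antisym sum_nonneg) auto
  then have "d x = 0" for x
    by (subst (asm) sum_nonneg_eq_0_iff) auto
  then show ?thesis
    by (auto simp: d_def)
qed

text \<open>Windows \<open>u = (u\<^sub>1, \<dots>, u\<^sub>n)\<close> are lists of length \<open>n\<close>; list positions start at \<open>0\<close>,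
  so \<open>u\<^sub>i\<close> is \<open>u ! (i - 1)\<close>.\<close>

definition windows :: "nat \<Rightarrow> 'a list set" where
  "windows n = {u. length u = n}"

definition path_law :: "('a \<Rightarrow> 'a \<Rightarrow> real) \<Rightarrow> ('a \<Rightarrow> real) \<Rightarrow> 'a list \<Rightarrow> real" where
  "path_law p \<pi> u = \<pi> (hd u) * (\<Prod>i<length u - 1. p (u ! i) (u ! Suc i))"

definition counts :: "'a list \<Rightarrow> 'a \<Rightarrow> nat" where
  "counts u = (\<lambda>x. card {i. i < length u \<and> u ! i = x})"

definition count_states :: "nat \<Rightarrow> ('a::finite \<Rightarrow> nat) set" where
  "count_states n = {\<eta>. (\<Sum>x\<in>UNIV. \<eta> x) = n}"

definition count_law ::
  "('a \<Rightarrow> 'a \<Rightarrow> real) \<Rightarrow> ('a \<Rightarrow> real) \<Rightarrow> nat \<Rightarrow> ('a \<Rightarrow> nat) \<Rightarrow> real" where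
  "count_law p \<pi> n \<eta> = (\<Sum>u\<in>{u \<in> windows n. counts u = \<eta>}. path_law p \<pi> u)"

definition unit_vec :: "'a \<Rightarrow> 'a \<Rightarrow> nat" where
  "unit_vec x = (\<lambda>y. of_bool (y = x))"

text \<open>The subtraction in \<open>\<eta> - e\<^bsub>u\<^sub>1\<^esub> + e\<^sub>z\<close> is never truncated, because \<open>counts u = \<eta>\<close> and
  \<open>n > 0\<close> imply that \<open>\<eta>\<close> is positive at \<open>u\<^sub>1\<close>.\<close>

definition count_kernel ::
  "('a::finite \<Rightarrow> 'a \<Rightarrow> real) \<Rightarrow> ('a \<Rightarrow> real) \<Rightarrow> nat \<Rightarrow> ('a \<Rightarrow> nat) \<Rightarrow> ('a \<Rightarrow> nat) \<Rightarrow> real" where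
  "count_kernel p \<pi> n \<eta> \<xi> =
     1 / count_law p \<pi> n \<eta> *
     (\<Sum>u\<in>{u \<in> windows n. counts u = \<eta>}. path_law p \<pi> u *
        (\<Sum>z\<in>UNIV. p (last u) z *
           of_bool ((\<lambda>x. \<eta> x - unit_vec (hd u) x + unit_vec z x) = \<xi>)))"

definition dirichlet_form ::
  "'s set \<Rightarrow> ('s \<Rightarrow> real) \<Rightarrow> ('s \<Rightarrow> 's \<Rightarrow> real) \<Rightarrow> ('s \<Rightarrow> real) \<Rightarrow> real" where
  "dirichlet_form S \<rho> K f = 1 / 2 * (\<Sum>x\<in>S. \<Sum>y\<in>S. \<rho> x * K x y * (f y - f x)\<^sup>2)"

definition var_on :: "'s set \<Rightarrow> ('s \<Rightarrow> real) \<Rightarrow> ('s \<Rightarrow> real) \<Rightarrow> real" where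
  "var_on S \<rho> f = (\<Sum>x\<in>S. \<rho> x * (f x - (\<Sum>y\<in>S. \<rho> y * f y))\<^sup>2)"

text \<open>Test functions are total, but only their values on \<open>S\<close> enter the quotient. The infimum
  is that of the reals: it is meaningful when \<open>S\<close> has at least two points of positive mass,
  for then the set of quotients is nonempty, and it is bounded below by \<open>0\<close>.\<close>

definition spectral_gap :: "'s set \<Rightarrow> ('s \<Rightarrow> real) \<Rightarrow> ('s \<Rightarrow> 's \<Rightarrow> real) \<Rightarrow> real" where
  "spectral_gap S \<rho> K = Inf {dirichlet_form S \<rho> K f / var_on S \<rho> f | f. var_on S \<rho> f > 0}"

definition count_gap :: "('a::finite \<Rightarrow> 'a \<Rightarrow> real) \<Rightarrow> ('a \<Rightarrow> real) \<Rightarrow> nat \<Rightarrow> real" where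
  "count_gap p \<pi> n = spectral_gap (count_states n) (count_law p \<pi> n) (count_kernel p \<pi> n)"

end

theory Submission
  imports Defs
begin

text \<open>Lower bound: as all entries of \<open>p\<close> are bounded below, the rows of \<open>p\<close> contract towards
  each other, and a martingale argument along the chain bounds the variance of a function of the
  window by the sum over the \<open>n\<close> sites of the mean squared change under replacing the letter at
  that site. For a function of the counts, the letter to be replaced may first be moved to the
  front of the window, at the price of a constant factor in the path weight. The replacement then
  is a step of the count chain, up to another constant, so that each of the \<open>n\<close> terms is
  bounded by the Dirichlet form.

  Upper bound: the number of occurrences of one letter changes by at most one in a step, while
  its variance grows linearly in \<open>n\<close>.\<close>

section \<open>Weighted sums\<close>

lemma weighted_square_le:
  fixes w f :: "'b \<Rightarrow> real"
  assumes "\<And>i. i \<in> A \<Longrightarrow> 0 \<le> w i"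
  shows "(\<Sum>i\<in>A. w i * f i)\<^sup>2 \<le> (\<Sum>i\<in>A. w i) * (\<Sum>i\<in>A. w i * (f i)\<^sup>2)"
proof -
  have "(\<Sum>i\<in>A. w i * f i) = (\<Sum>i\<in>A. sqrt (w i) * (sqrt (w i) * f i))"
    using assms by (intro sum.cong) (auto simp flip: mult.assoc)
  also have "\<dots>\<^sup>2 \<le> (\<Sum>i\<in>A. (sqrt (w i))\<^sup>2) * (\<Sum>i\<in>A. (sqrt (w i) * f i)\<^sup>2)"
    by (rule Cauchy_Schwarz_ineq_sum)
  also have "\<dots> = (\<Sum>i\<in>A. w i) * (\<Sum>i\<in>A. w i * (f i)\<^sup>2)"
    using assms by (simp add: power_mult_distrib)
  finally show ?thesis .
qed

lemma weighted_variance: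
  fixes w f :: "'b \<Rightarrow> real"
  assumes "(\<Sum>i\<in>A. w i) = 1"
  shows "(\<Sum>i\<in>A. w i * (f i - k)\<^sup>2) =
    (\<Sum>i\<in>A. w i * (f i)\<^sup>2) - 2 * k * (\<Sum>i\<in>A. w i * f i) + k\<^sup>2"
proof -
  have "(\<Sum>i\<in>A. w i * (f i - k)\<^sup>2) =
    (\<Sum>i\<in>A. w i * (f i)\<^sup>2 - 2 * k * (w i * f i) + w i * k\<^sup>2)"
    by (intro sum.cong) (auto simp: power2_eq_square algebra_simps)
  also have "\<dots> = (\<Sum>i\<in>A. w i * (f i)\<^sup>2) - 2 * k * (\<Sum>i\<in>A. w i * f i) + (\<Sum>i\<in>A. w i) * k\<^sup>2"
    by (simp add: sum.distrib sum_subtractf sum_distrib_left sum_distrib_right)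
  finally show ?thesis
    using assms by simp
qed

lemma weighted_variance_le:
  fixes w f :: "'b \<Rightarrow> real"
  assumes "(\<Sum>i\<in>A. w i) = 1"
  shows "(\<Sum>i\<in>A. w i * (f i - (\<Sum>j\<in>A. w j * f j))\<^sup>2) \<le> (\<Sum>i\<in>A. w i * (f i - k)\<^sup>2)"
proof -
  have "0 \<le> ((\<Sum>j\<in>A. w j * f j) - k)\<^sup>2"
    by simp
  then show ?thesis
    unfolding weighted_variance[OF assms] by (simp add: power2_eq_square algebra_simps)
qed

text \<open>The right side exceeds the left by \<open>(a - e * b)^2 / e\<close>. The free parameter
  \<open>e\<close> later keeps a contraction factor below one.\<close>

lemma square_add_le:
  fixes a b e :: real
  assumes "0 < e"
  shows "(a + b)\<^sup>2 \<le> (1 + 1 / e) * a\<^sup>2 + (1 + e) * b\<^sup>2"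
proof -
  have "0 \<le> (a - e * b)\<^sup>2 / e"
    using assms by simp
  then show ?thesis
    using assms by (simp add: power2_eq_square field_simps)
qed

section \<open>Windows and counts\<close>

lemma finite_windows: "finite (windows n :: 'a::finite list set)"
  using finite_lists_length_eq[of "UNIV :: 'a set" n] by (simp add: windows_def)

lemma sum_windows_Suc:
  "(\<Sum>u\<in>windows (Suc n). F u) = (\<Sum>z\<in>UNIV. \<Sum>u\<in>windows n. F (z # u))"
  for F :: "'a::finite list \<Rightarrow> real"
proof -
  have "windows (Suc n) = (\<lambda>(z :: 'a, u). z # u) ` (UNIV \<times> windows n)"
    by (auto simp: windows_def length_Suc_conv image_iff)
  moreover have "inj_on (\<lambda>(z :: 'a, u). z # u) (UNIV \<times> windows n)"
    by (auto simp: inj_on_def)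
  ultimately have "(\<Sum>u\<in>windows (Suc n). F u) = (\<Sum>(z, u)\<in>UNIV \<times> windows n. F (z # u))"
    by (simp add: sum.reindex case_prod_unfold)
  then show ?thesis
    by (simp add: sum.cartesian_product)
qed

lemma counts_eq_count_mset: "counts u = count (mset u)"
proof
  fix x
  have "{i. i < length u \<and> u ! i = x} = {i. i < length u \<and> x = u ! i}"
    by auto
  then show "counts u x = count (mset u) x"
    by (simp add: counts_def count_mset count_list_eq_length_filter length_filter_conv_card)
qed

lemma counts_in_count_states: "u \<in> windows n \<Longrightarrow> counts u \<in> count_states n" for u :: "'a::finite list"
proof -
  have "(\<Sum>x\<in>UNIV. count (mset u) x) = size (mset u)"
    unfolding size_multiset_overloaded_eq
    by (rule sum.mono_neutral_right) (auto simp: not_in_iff)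
  then show "u \<in> windows n \<Longrightarrow> counts u \<in> count_states n"
    by (simp add: count_states_def counts_eq_count_mset windows_def)
qed

text \<open>Identifies the target of a step of the count kernel with the counts of the shifted
  window, trading the truncated subtraction for list operations.\<close>

lemma counts_shift:
  assumes "u \<noteq> []"
  shows "(\<lambda>x. counts u x - unit_vec (hd u) x + unit_vec z x) = counts (tl u @ [z])"
  using assms by (cases u) (auto simp: counts_eq_count_mset unit_vec_def fun_eq_iff)

lemma finite_count_states: "finite (count_states n :: ('a::finite \<Rightarrow> nat) set)"
proof (rule finite_subset)
  show "count_states n \<subseteq> (\<Pi>\<^sub>E x\<in>(UNIV :: 'a set). {..n})"
    by (auto simp: count_states_def PiE_UNIV_domain intro!: member_le_sum)
qed (auto intro: finite_PiE)

section \<open>Path expectations\<close>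

text \<open>The first letter has an arbitrary law \<open>q\<close>, so that conditioning on it leads to a
  path expectation of the same kind, with \<open>p z\<close> in place of \<open>q\<close>.\<close>

fun path_weight :: "('a \<Rightarrow> 'a \<Rightarrow> real) \<Rightarrow> ('a \<Rightarrow> real) \<Rightarrow> 'a list \<Rightarrow> real" where
  "path_weight p q [] = 1"
| "path_weight p q (x # u) = q x * path_weight p (p x) u"

text \<open>The empty window is excluded because \<open>path_law\<close> evaluates \<open>q\<close>
  at \<open>hd []\<close> there, whereas \<open>path_weight\<close> is 1. This is the source of the
  assumption \<open>0 < n\<close> further on.\<close>

lemma path_law_eq_path_weight: "u \<noteq> [] \<Longrightarrow> path_law p q u = path_weight p q u"
proof (induction u arbitrary: q)
  case (Cons x u)
  show ?case
  proof (cases "u = []")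
    case False
    then have "path_law p (p x) u = path_weight p (p x) u"
      by (rule Cons.IH)
    moreover obtain m where "length u = Suc m"
      using False by (cases u) auto
    ultimately show ?thesis
      using False
      by (simp add: path_law_def prod.lessThan_Suc_shift hd_conv_nth del: prod.lessThan_Suc)
  qed (simp add: path_law_def)
qed simp

section \<open>Kernels bounded below, and comparison of path weights\<close>

locale positive_kernel =
  fixes p :: "'a::finite \<Rightarrow> 'a \<Rightarrow> real" and c :: real
  assumes c_pos: "0 < c"
    and c_le_p: "c \<le> p x y"
    and sum_p: "(\<Sum>y\<in>UNIV. p x y) = 1"
begin

text \<open>The same \<open>c\<close> bounds the initial law and all rows of \<open>p\<close>, so
  the class is stable under conditioning on the first letter.\<close>

definition minorized :: "('a \<Rightarrow> real) \<Rightarrow> bool" where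
  "minorized q \<longleftrightarrow> (\<forall>x. c \<le> q x) \<and> (\<Sum>x\<in>UNIV. q x) = 1"

lemma minorized_p [simp]: "minorized (p x)"
  by (simp add: minorized_def c_le_p sum_p)

lemma minorized_ge: "minorized q \<Longrightarrow> c \<le> q x"
  by (simp add: minorized_def)

lemma minorized_sum: "minorized q \<Longrightarrow> (\<Sum>x\<in>UNIV. q x) = 1"
  by (simp add: minorized_def)

lemma minorized_nonneg: "minorized q \<Longrightarrow> 0 \<le> q x"
  using minorized_ge[of q x] c_pos by simp

lemma minorized_le_1:
  assumes "minorized q"
  shows "q x \<le> 1"
proof -
  have "q x \<le> (\<Sum>x\<in>UNIV. q x)"
    using minorized_nonneg[OF assms] by (intro member_le_sum) auto
  then show ?thesis
    by (simp add: minorized_sum[OF assms])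
qed

lemma p_nonneg: "0 \<le> p x y"
  by (rule minorized_nonneg) simp

lemma c_le_1: "c \<le> 1"
  using c_le_p[of undefined undefined] minorized_le_1[of "p undefined" undefined] by simp

lemma path_weight_nonneg: "minorized q \<Longrightarrow> 0 \<le> path_weight p q u"
  by (induction u arbitrary: q) (simp_all add: minorized_nonneg)

text \<open>The initial law enters through the first factor only, and
  \<open>c * q x \<le> c \<le> q' x\<close>.\<close>

lemma path_weight_compare:
  assumes "minorized q" "minorized q'"
  shows "c * path_weight p q u \<le> path_weight p q' u"
proof (cases u)
  case (Cons x v)
  have "c * q x \<le> q' x"
    using mult_left_mono[OF minorized_le_1[OF assms(1), of x], of c] minorized_ge[OF assms(2), of x] c_pos
    by linarith
  then show ?thesis
    using Cons path_weight_nonneg[of "p x" v]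
    by (simp flip: mult.assoc add: mult_right_mono)
qed (use c_le_1 in simp)

text \<open>By induction the letter stands in front. Its own factor is at most 1, and the rest then
  starts from \<open>q\<close> instead of \<open>p y\<close>, which costs one factor
  \<open>c\<close>.\<close>

lemma path_weight_delete:
  assumes "minorized q"
  shows "c * path_weight p q (xs @ y # zs) \<le> path_weight p q (xs @ zs)"
  using assms
proof (induction xs arbitrary: q)
  case Nil
  have "c * (q y * path_weight p (p y) zs) \<le> c * path_weight p (p y) zs"
    using c_pos minorized_le_1[OF Nil, of y] path_weight_nonneg[of "p y" zs]
    by (simp add: mult_left_le_one_le minorized_nonneg[OF Nil])
  also have "\<dots> \<le> path_weight p q zs"
    using Nil by (intro path_weight_compare) auto
  finally show ?case
    by simp
next
  case (Cons x xs)
  have "q x * (c * path_weight p (p x) (xs @ y # zs)) \<le> q x * path_weight p (p x) (xs @ zs)"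
    by (intro mult_left_mono Cons.IH minorized_p minorized_nonneg Cons.prems)
  then show ?case
    by (simp add: mult_ac)
qed

text \<open>One factor \<open>c\<close> each for deleting \<open>y\<close>, for starting the rest
  from \<open>p y\<close>, and for the new first factor \<open>q y\<close>.\<close>

lemma path_weight_move_to_front:
  assumes "minorized q"
  shows "c ^ 3 * path_weight p q (xs @ y # zs) \<le> path_weight p q (y # xs @ zs)"
proof -
  have "c ^ 3 * path_weight p q (xs @ y # zs) = c * (c * (c * path_weight p q (xs @ y # zs)))"
    by (simp add: power3_eq_cube)
  also have "\<dots> \<le> c * (c * path_weight p q (xs @ zs))"
    using c_pos assms by (intro mult_left_mono path_weight_delete) auto
  also have "\<dots> \<le> c * path_weight p (p y) (xs @ zs)"
    using c_pos assms by (intro mult_left_mono path_weight_compare) auto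
  also have "\<dots> \<le> q y * path_weight p (p y) (xs @ zs)"
    using assms by (intro mult_right_mono minorized_ge path_weight_nonneg) auto
  finally show ?thesis
    by simp
qed

section \<open>Mean and variance under the path weight\<close>

definition path_mean :: "nat \<Rightarrow> ('a \<Rightarrow> real) \<Rightarrow> ('a list \<Rightarrow> real) \<Rightarrow> real" where
  "path_mean n q F = (\<Sum>u\<in>windows n. path_weight p q u * F u)"

lemma path_mean_0 [simp]: "path_mean 0 q F = F []"
  by (simp add: path_mean_def windows_def)

lemma path_mean_Suc:
  "path_mean (Suc n) q F = (\<Sum>z\<in>UNIV. q z * path_mean n (p z) (\<lambda>u. F (z # u)))"
  by (simp add: path_mean_def sum_windows_Suc sum_distrib_left mult.assoc)

lemma path_mean_const [simp]: "minorized q \<Longrightarrow> path_mean n q (\<lambda>_. k) = k"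
  by (induction n arbitrary: q)
    (simp_all add: path_mean_Suc minorized_sum flip: sum_distrib_right)

lemma sum_path_weight: "minorized q \<Longrightarrow> (\<Sum>u\<in>windows n. path_weight p q u) = 1"
  using path_mean_const[of q n 1] by (simp add: path_mean_def)

lemma path_mean_mono:
  "minorized q \<Longrightarrow> (\<And>u. u \<in> windows n \<Longrightarrow> F u \<le> G u) \<Longrightarrow> path_mean n q F \<le> path_mean n q G"
  unfolding path_mean_def by (intro sum_mono mult_left_mono path_weight_nonneg)

lemma path_mean_nonneg: "minorized q \<Longrightarrow> (\<And>u. 0 \<le> F u) \<Longrightarrow> 0 \<le> path_mean n q F"
  unfolding path_mean_def by (intro sum_nonneg mult_nonneg_nonneg path_weight_nonneg)

lemma path_mean_add: "path_mean n q (\<lambda>u. F u + G u) = path_mean n q F + path_mean n q G"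
  by (simp add: path_mean_def distrib_left sum.distrib)

lemma path_mean_diff: "path_mean n q (\<lambda>u. F u - G u) = path_mean n q F - path_mean n q G"
  by (simp add: path_mean_def right_diff_distrib sum_subtractf)

lemma path_mean_cmult: "path_mean n q (\<lambda>u. k * F u) = k * path_mean n q F"
  by (simp add: path_mean_def sum_distrib_left mult_ac)

lemma path_mean_square_le:
  "minorized q \<Longrightarrow> (path_mean n q F)\<^sup>2 \<le> path_mean n q (\<lambda>u. (F u)\<^sup>2)"
  unfolding path_mean_def
  using weighted_square_le[of "windows n" "path_weight p q" F] path_weight_nonneg
  by (simp add: sum_path_weight)

lemma path_mean_compare:
  assumes "minorized q" "minorized q'" "\<And>u. 0 \<le> F u"
  shows "c * path_mean n q F \<le> path_mean n q' F"
  unfolding path_mean_def sum_distrib_left mult.assoc[symmetric]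
  using assms by (intro sum_mono mult_right_mono path_weight_compare)

definition path_var :: "nat \<Rightarrow> ('a \<Rightarrow> real) \<Rightarrow> ('a list \<Rightarrow> real) \<Rightarrow> real" where
  "path_var n q F = path_mean n q (\<lambda>u. (F u - path_mean n q F)\<^sup>2)"

lemma path_var_eq:
  assumes "minorized q"
  shows "path_var n q F = path_mean n q (\<lambda>u. (F u)\<^sup>2) - (path_mean n q F)\<^sup>2"
  unfolding path_var_def path_mean_def weighted_variance[OF sum_path_weight[OF assms]]
  by (simp add: power2_eq_square)

lemma path_var_nonneg: "minorized q \<Longrightarrow> 0 \<le> path_var n q F"
  unfolding path_var_def by (intro path_mean_nonneg) auto

lemma path_var_add_const: "minorized q \<Longrightarrow> path_var n q (\<lambda>u. k + F u) = path_var n q F"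
  by (simp add: path_var_def path_mean_add)

text \<open>The law of total variance, conditioning on the first letter.\<close>

lemma path_var_Suc:
  fixes F and n :: nat
  defines "M \<equiv> \<lambda>z. path_mean n (p z) (\<lambda>u. F (z # u))"
  assumes q: "minorized q"
  shows "path_var (Suc n) q F = (\<Sum>z\<in>UNIV. q z * path_var n (p z) (\<lambda>u. F (z # u))) +
    (\<Sum>z\<in>UNIV. q z * (M z - (\<Sum>y\<in>UNIV. q y * M y))\<^sup>2)"
proof -
  have "(\<Sum>z\<in>UNIV. q z * path_var n (p z) (\<lambda>u. F (z # u))) =
    path_mean (Suc n) q (\<lambda>u. (F u)\<^sup>2) - (\<Sum>z\<in>UNIV. q z * (M z)\<^sup>2)"
    by (simp add: path_var_eq path_mean_Suc M_def right_diff_distrib sum_subtractf)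
  moreover have "path_mean (Suc n) q F = (\<Sum>y\<in>UNIV. q y * M y)"
    by (simp add: path_mean_Suc M_def)
  ultimately show ?thesis
    unfolding path_var_eq[OF q] weighted_variance[OF minorized_sum[OF q]]
    by (simp add: power2_eq_square)
qed

section \<open>A Poincare inequality for single-letter changes\<close>

text \<open>The new letter \<open>b\<close> is summed without weights, which avoids the conditional
  law of a letter given its neighbours.\<close>

definition site_energy :: "nat \<Rightarrow> ('a \<Rightarrow> real) \<Rightarrow> ('a list \<Rightarrow> real) \<Rightarrow> nat \<Rightarrow> real" where
  "site_energy n q F i = path_mean n q (\<lambda>u. \<Sum>b\<in>UNIV. (F u - F (u[i := b]))\<^sup>2)"

text \<open>Given the first letter \<open>z\<close>, a change at site \<open>Suc i\<close> of the
  window is a change at site \<open>i\<close> of the tail. This fits the induction on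
  \<open>n\<close>.\<close>

lemma sum_site_energy_Suc:
  "(\<Sum>i<Suc n. site_energy (Suc n) q F i) = site_energy (Suc n) q F 0 +
    (\<Sum>z\<in>UNIV. q z * (\<Sum>i<n. site_energy n (p z) (\<lambda>u. F (z # u)) i))"
proof -
  have "(\<Sum>i<n. site_energy (Suc n) q F (Suc i)) =
    (\<Sum>z\<in>UNIV. q z * (\<Sum>i<n. site_energy n (p z) (\<lambda>u. F (z # u)) i))"
    unfolding sum_distrib_left
    by (subst sum.swap) (simp add: site_energy_def path_mean_Suc)
  then show ?thesis
    by (simp add: sum.lessThan_Suc_shift del: sum.lessThan_Suc)
qed

section \<open>Oscillation of the conditional mean given the first letter\<close>

definition mean_after :: "nat \<Rightarrow> ('a list \<Rightarrow> real) \<Rightarrow> 'a \<Rightarrow> real" where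
  "mean_after n F z = path_mean n (p z) (\<lambda>u. F (z # u))"

text \<open>The maximum over \<open>y\<close> leaves the law of the second letter free, as a
  coupling requires; only \<open>z\<close> is averaged in \<open>spread\<close>.\<close>

definition spread_at :: "nat \<Rightarrow> ('a list \<Rightarrow> real) \<Rightarrow> 'a \<Rightarrow> real" where
  "spread_at n F z = Max (range (\<lambda>y. (mean_after n F y - mean_after n F z)\<^sup>2))"

fun spread :: "nat \<Rightarrow> ('a \<Rightarrow> real) \<Rightarrow> ('a list \<Rightarrow> real) \<Rightarrow> real" where
  "spread 0 q F = 0"
| "spread (Suc n) q F = (\<Sum>z\<in>UNIV. q z * spread_at n F z)"

lemma spread_at_ge: "(mean_after n F y - mean_after n F z)\<^sup>2 \<le> spread_at n F z"
  unfolding spread_at_def by (intro Max_ge) auto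

lemma spread_at_le:
  "(\<And>y. (mean_after n F y - mean_after n F z)\<^sup>2 \<le> B) \<Longrightarrow> spread_at n F z \<le> B"
  unfolding spread_at_def by (intro Max.boundedI) auto

lemma spread_at_nonneg: "0 \<le> spread_at n F z"
  using spread_at_ge[of n F z z] by simp

text \<open>The mass of a row outside the common part \<open>c\<close>: the probability that a
  Doeblin coupling of two rows does not use that part.\<close>

definition slack :: real where
  "slack = 1 - real (CARD('a)) * c"

lemma slack_eq: "(\<Sum>y\<in>UNIV. p x y - c) = slack"
  by (simp add: slack_def sum_subtractf sum_p)

lemma slack_bounds: "0 \<le> slack" "slack < 1"
proof -
  show "0 \<le> slack"
    unfolding slack_eq[of undefined, symmetric] using c_le_p by (intro sum_nonneg) auto
  show "slack < 1"
    using c_pos by (simp add: slack_def)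
qed

text \<open>After removal of the common part \<open>c\<close> of all rows, the two rows are coupled
  independently.\<close>

lemma mean_shift_square_le:
  "(path_mean n (p y) H - path_mean n (p z) H)\<^sup>2 \<le> slack * spread n (p z) H"
proof (cases n)
  case (Suc m)
  define g where "g = mean_after m H"
  define r where "r x a = p x a - c" for x a
  have r_nonneg: "0 \<le> r x a" for x a
    using c_le_p by (simp add: r_def)
  have sum_r: "(\<Sum>a\<in>UNIV. r x a) = slack" for x
    by (simp add: r_def slack_eq)
  let ?d = "path_mean n (p y) H - path_mean n (p z) H"
  have d: "?d = (\<Sum>a\<in>UNIV. r y a * g a) - (\<Sum>b\<in>UNIV. r z b * g b)"
    by (simp add: Suc path_mean_Suc r_def g_def mean_after_def left_diff_distrib sum_subtractf)
  \<comment> \<open>The factor \<open>slack\<close> supplies the total mass of the other residual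
    row, so that the difference of means becomes one sum over pairs of letters.\<close>
  have "slack * ?d = (\<Sum>a\<in>UNIV. r y a * g a) * (\<Sum>b\<in>UNIV. r z b)
      - (\<Sum>a\<in>UNIV. r y a) * (\<Sum>b\<in>UNIV. r z b * g b)"
    by (simp add: d sum_r algebra_simps)
  also have "\<dots> = (\<Sum>a\<in>UNIV. \<Sum>b\<in>UNIV. r y a * r z b * (g a - g b))"
    unfolding sum_product by (simp add: sum_subtractf right_diff_distrib mult_ac)
  finally have *: "slack * ?d = (\<Sum>(a, b)\<in>UNIV. r y a * r z b * (g a - g b))"
    by (simp add: sum.cartesian_product)
  have "(slack * ?d)\<^sup>2 \<le> (\<Sum>(a, b)\<in>UNIV. r y a * r z b) *
      (\<Sum>(a, b)\<in>UNIV. r y a * r z b * (g a - g b)\<^sup>2)"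
    unfolding * using weighted_square_le[of UNIV "\<lambda>(a, b). r y a * r z b" "\<lambda>(a, b). g a - g b"]
    by (simp add: case_prod_unfold r_nonneg)
  also have "(\<Sum>(a, b)\<in>UNIV. r y a * r z b) = slack\<^sup>2"
    using sum_product[of "r y" UNIV "r z" UNIV]
    by (simp add: sum.cartesian_product sum_r power2_eq_square)
  also have "(\<Sum>(a, b)\<in>UNIV. r y a * r z b * (g a - g b)\<^sup>2) =
      (\<Sum>a\<in>UNIV. \<Sum>b\<in>UNIV. r y a * r z b * (g a - g b)\<^sup>2)"
    by (simp add: sum.cartesian_product)
  \<comment> \<open>Here \<open>r z b \<le> p z b\<close>, while \<open>r y a\<close> is kept: its
    sum over \<open>a\<close> yields the factor \<open>slack\<close>.\<close>
  also have "\<dots> \<le> (\<Sum>a\<in>UNIV. \<Sum>b\<in>UNIV. r y a * (p z b * spread_at m H b))"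
    unfolding mult.assoc
    by (intro sum_mono mult_left_mono mult_mono)
      (use c_pos in \<open>auto simp: g_def spread_at_ge spread_at_nonneg r_nonneg p_nonneg\<close>,
       auto simp: r_def)
  also have "\<dots> = slack * spread n (p z) H"
    by (simp add: Suc sum_r flip: sum_distrib_left sum_distrib_right)
  finally have main: "slack\<^sup>2 * ?d\<^sup>2 \<le> slack\<^sup>2 * (slack * spread n (p z) H)"
    by (simp add: power_mult_distrib mult_left_mono)
  show ?thesis
  \<comment> \<open>For zero slack the factor \<open>slack\<^sup>2\<close> cannot be cancelled, but
    then the residual rows vanish and the two means agree.\<close>
  proof (cases "slack = 0")
    case True
    have "r x a = 0" for x a
      using sum_r[of x] True r_nonneg by (simp add: sum_nonneg_eq_0_iff)
    then show ?thesis
      using d True by simp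
  qed (use main in \<open>simp add: mult_le_cancel_left\<close>)
qed simp

text \<open>The numerator is the first factor of \<open>square_add_le\<close> for
  \<open>e = 1 - slack\<close>; the division by \<open>c\<close> pays for a change of the tail
  law.\<close>

definition "site_const = (1 + 1 / (1 - slack)) / c"

text \<open>The factor \<open>slack\<close> from the coupling times \<open>1 + e\<close> for
  \<open>e = 1 - slack\<close>. It equals \<open>1 - (1 - slack)^2\<close>, hence is below
  one.\<close>

definition "contraction = slack * (2 - slack)"

lemma contraction_bounds: "0 \<le> contraction" "contraction < 1"
proof -
  show "0 \<le> contraction"
    unfolding contraction_def using slack_bounds by simp
  have "0 < (1 - slack)\<^sup>2"
    using slack_bounds by simp
  then show "contraction < 1"
    by (simp add: contraction_def power2_eq_square algebra_simps)
qed

lemma site_const_pos: "0 < site_const"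
  unfolding site_const_def using slack_bounds c_pos
  by (intro divide_pos_pos add_pos_pos) auto

text \<open>Replacing \<open>z\<close> by \<open>y\<close> changes the conditional mean in two ways:
  \<alpha> changes the letter inside \<open>F\<close> under a fixed tail law, \<beta> changes the
  tail law under a fixed function. The first is controlled by the energy at site 0 after comparing
  \<open>p y\<close> with \<open>p z\<close>, the second by the coupling.\<close>

lemma spread_at_recursion:
  "spread_at n F z \<le> site_const * path_mean n (p z) (\<lambda>u. \<Sum>b\<in>UNIV. (F (z # u) - F (b # u))\<^sup>2)
    + contraction * spread n (p z) (\<lambda>u. F (z # u))"
proof (rule spread_at_le)
  fix y
  define \<alpha> where "\<alpha> = path_mean n (p y) (\<lambda>u. F (y # u) - F (z # u))"
  define \<beta> where "\<beta> = path_mean n (p y) (\<lambda>u. F (z # u)) - path_mean n (p z) (\<lambda>u. F (z # u))"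
  let ?D = "path_mean n (p z) (\<lambda>u. \<Sum>b\<in>UNIV. (F (z # u) - F (b # u))\<^sup>2)"
  have eq: "mean_after n F y - mean_after n F z = \<alpha> + \<beta>"
    by (simp add: mean_after_def \<alpha>_def \<beta>_def path_mean_diff)
  have "c * \<alpha>\<^sup>2 \<le> c * path_mean n (p y) (\<lambda>u. (F (y # u) - F (z # u))\<^sup>2)"
    unfolding \<alpha>_def using c_pos by (intro mult_left_mono path_mean_square_le) auto
  also have "\<dots> \<le> path_mean n (p z) (\<lambda>u. (F (y # u) - F (z # u))\<^sup>2)"
    by (intro path_mean_compare) auto
  also have "\<dots> \<le> ?D"
  proof (intro path_mean_mono minorized_p)
    fix u
    have "(F (z # u) - F (y # u))\<^sup>2 \<le> (\<Sum>b\<in>UNIV. (F (z # u) - F (b # u))\<^sup>2)"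
      by (intro member_le_sum) auto
    then show "(F (y # u) - F (z # u))\<^sup>2 \<le> (\<Sum>b\<in>UNIV. (F (z # u) - F (b # u))\<^sup>2)"
      by (simp add: power2_commute)
  qed
  finally have \<alpha>: "\<alpha>\<^sup>2 \<le> ?D / c"
    using c_pos by (simp add: pos_le_divide_eq mult.commute)
  have \<beta>: "\<beta>\<^sup>2 \<le> slack * spread n (p z) (\<lambda>u. F (z # u))"
    unfolding \<beta>_def by (rule mean_shift_square_le)
  have "(\<alpha> + \<beta>)\<^sup>2 \<le> (1 + 1 / (1 - slack)) * \<alpha>\<^sup>2 + (1 + (1 - slack)) * \<beta>\<^sup>2"
    using slack_bounds by (intro square_add_le) simp
  also have "\<dots> \<le> (1 + 1 / (1 - slack)) * (?D / c) +
      (1 + (1 - slack)) * (slack * spread n (p z) (\<lambda>u. F (z # u)))"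
    using slack_bounds by (intro add_mono mult_left_mono \<alpha> \<beta>) auto
  finally show "(mean_after n F y - mean_after n F z)\<^sup>2 \<le>
      site_const * ?D + contraction * spread n (p z) (\<lambda>u. F (z # u))"
    unfolding eq by (simp add: site_const_def contraction_def mult_ac)
qed

lemma spread_recursion:
  assumes q: "minorized q"
  shows "spread (Suc n) q F \<le> site_const * site_energy (Suc n) q F 0
    + contraction * (\<Sum>z\<in>UNIV. q z * spread n (p z) (\<lambda>u. F (z # u)))"
proof -
  have "spread (Suc n) q F \<le> (\<Sum>z\<in>UNIV. q z *
      (site_const * path_mean n (p z) (\<lambda>u. \<Sum>b\<in>UNIV. (F (z # u) - F (b # u))\<^sup>2)
        + contraction * spread n (p z) (\<lambda>u. F (z # u))))"
    unfolding spread.simps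
    by (intro sum_mono mult_left_mono spread_at_recursion minorized_nonneg q)
  also have "\<dots> = site_const * site_energy (Suc n) q F 0
      + contraction * (\<Sum>z\<in>UNIV. q z * spread n (p z) (\<lambda>u. F (z # u)))"
    by (simp add: site_energy_def path_mean_Suc distrib_left sum.distrib sum_distrib_left mult_ac)
  finally show ?thesis .
qed

text \<open>The weight \<open>contraction / (1 - contraction)\<close> of the spread is the one for which the
  induction closes.\<close>

lemma path_var_spread_le:
  assumes "minorized q"
  shows "path_var n q F + contraction / (1 - contraction) * spread n q F
    \<le> site_const / (1 - contraction) * (\<Sum>i<n. site_energy n q F i)"
  using assms
proof (induction n arbitrary: q F)
  case 0
  then show ?case
    by (simp add: path_var_def)
next
  case (Suc n)
  note q = \<open>minorized q\<close>
  let ?\<theta> = contraction and ?F = "\<lambda>z u. F (z # u)"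
  let ?M = "mean_after n F"
  \<comment> \<open>The mean is replaced by the value at an arbitrary reference letter, here
    \<open>undefined\<close>, so that \<open>spread_at\<close> applies.\<close>
  have "(\<Sum>z\<in>UNIV. q z * (?M z - (\<Sum>y\<in>UNIV. q y * ?M y))\<^sup>2) \<le>
      (\<Sum>z\<in>UNIV. q z * (?M z - ?M undefined)\<^sup>2)"
    by (rule weighted_variance_le[OF minorized_sum[OF q]])
  also have "\<dots> \<le> spread (Suc n) q F"
    unfolding spread.simps
  proof (intro sum_mono mult_left_mono minorized_nonneg q)
    fix z
    show "(?M z - ?M undefined)\<^sup>2 \<le> spread_at n F z"
      using spread_at_ge[of n F undefined z] by (simp add: power2_commute)
  qed
  finally have var: "path_var (Suc n) q F \<le>
      (\<Sum>z\<in>UNIV. q z * path_var n (p z) (?F z)) + spread (Suc n) q F"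
    by (simp add: path_var_Suc[OF q] mean_after_def)
  have pos: "0 < 1 - ?\<theta>"
    using contraction_bounds by simp
  \<comment> \<open>With \<theta> the contraction,
    \<open>1 + \<theta> / (1 - \<theta>) = 1 / (1 - \<theta>)\<close>; the factor \<theta> of the
    recursion then restores the weight \<open>\<theta> / (1 - \<theta>)\<close> one level
    down.\<close>
  have "spread (Suc n) q F + ?\<theta> / (1 - ?\<theta>) * spread (Suc n) q F =
      1 / (1 - ?\<theta>) * spread (Suc n) q F"
    using pos by (simp add: field_simps)
  also have "\<dots> \<le> 1 / (1 - ?\<theta>) * (site_const * site_energy (Suc n) q F 0
      + ?\<theta> * (\<Sum>z\<in>UNIV. q z * spread n (p z) (?F z)))"
    using pos by (intro mult_left_mono spread_recursion q) simp
  also have "\<dots> = site_const / (1 - ?\<theta>) * site_energy (Suc n) q F 0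
      + ?\<theta> / (1 - ?\<theta>) * (\<Sum>z\<in>UNIV. q z * spread n (p z) (?F z))"
    by (simp add: distrib_left)
  finally have "path_var (Suc n) q F + ?\<theta> / (1 - ?\<theta>) * spread (Suc n) q F \<le>
      site_const / (1 - ?\<theta>) * site_energy (Suc n) q F 0 +
      (\<Sum>z\<in>UNIV. q z * (path_var n (p z) (?F z) + ?\<theta> / (1 - ?\<theta>) * spread n (p z) (?F z)))"
    using var by (simp add: distrib_left sum.distrib sum_distrib_left mult_ac)
  also have "\<dots> \<le> site_const / (1 - ?\<theta>) * site_energy (Suc n) q F 0 +
      (\<Sum>z\<in>UNIV. q z * (site_const / (1 - ?\<theta>) * (\<Sum>i<n. site_energy n (p z) (?F z) i)))"
    by (intro add_left_mono sum_mono mult_left_mono Suc.IH minorized_p minorized_nonneg q)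
  also have "\<dots> = site_const / (1 - ?\<theta>) * (\<Sum>i<Suc n. site_energy (Suc n) q F i)"
    unfolding sum_site_energy_Suc by (simp add: distrib_left sum_distrib_left mult_ac)
  finally show ?case .
qed

lemma spread_nonneg: "minorized q \<Longrightarrow> 0 \<le> spread n q F"
  by (cases n) (simp_all add: sum_nonneg minorized_nonneg spread_at_nonneg)

lemma path_poincare:
  assumes "minorized q"
  shows "path_var n q F \<le> site_const / (1 - contraction) * (\<Sum>i<n. site_energy n q F i)"
proof -
  have "0 \<le> contraction / (1 - contraction) * spread n q F"
    using contraction_bounds spread_nonneg[OF assms] by simp
  then show ?thesis
    using path_var_spread_le[OF assms, of n F] by simp
qed

section \<open>The count chain\<close>

text \<open>For positive \<open>n\<close> and minorized \<open>q\<close>, twice the Dirichlet form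
  of the count chain, written over windows so that no division by \<open>count_law\<close>
  remains.\<close>

definition count_energy :: "nat \<Rightarrow> ('a \<Rightarrow> real) \<Rightarrow> (('a \<Rightarrow> nat) \<Rightarrow> real) \<Rightarrow> real" where
  "count_energy n q f = path_mean n q
    (\<lambda>u. \<Sum>z\<in>UNIV. p (last u) z * (f (counts (tl u @ [z])) - f (counts u))\<^sup>2)"

text \<open>Moving the \<open>i\<close>-th letter to the front preserves the counts and changes the path weight
  by a bounded factor only; afterwards a change of that letter is a step of the count chain.\<close>

lemma site_energy_counts_le:
  assumes q: "minorized q" and i: "i < n"
  shows "c ^ 4 * site_energy n q (\<lambda>u. f (counts u)) i \<le> count_energy n q f"
proof -
  define rot where "rot u = u ! i # take i u @ drop (Suc i) u" for u :: "'a list"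
  define g where "g u = (\<Sum>b\<in>UNIV. (f (counts (tl u @ [b])) - f (counts u))\<^sup>2)" for u :: "'a list"
  have g_nonneg: "0 \<le> g u" for u
    by (simp add: g_def sum_nonneg)
  have split: "u = take i u @ u ! i # drop (Suc i) u" if "u \<in> windows n" for u :: "'a list"
    using that i by (simp add: windows_def id_take_nth_drop)
  have rot_windows: "rot ` windows n \<subseteq> windows n"
    using i by (auto simp: rot_def windows_def)
  have inj: "inj_on rot (windows n)"
  proof (rule inj_onI)
    fix u v :: "'a list"
    assume u: "u \<in> windows n" and v: "v \<in> windows n" and eq: "rot u = rot v"
    have "length (take i u) = length (take i v)"
      using u v by (simp add: windows_def)
    with eq have "take i u = take i v" "u ! i = v ! i" "drop (Suc i) u = drop (Suc i) v"
      by (auto simp: rot_def)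
    then show "u = v"
      using split[OF u] split[OF v] by metis
  qed
  have g_rot: "(\<Sum>b\<in>UNIV. (f (counts u) - f (counts (u[i := b])))\<^sup>2) = g (rot u)"
    if u: "u \<in> windows n" for u
  proof -
    have "counts u = counts (rot u)"
      unfolding counts_eq_count_mset by (subst split[OF u]) (simp add: rot_def)
    \<comment> \<open>In \<open>rot u\<close> the letter in question stands first, so
      \<open>tl\<close> removes it, and \<open>b\<close> takes its place at the end.\<close>
    moreover have "counts (u[i := b]) = counts (tl (rot u) @ [b])" for b
      using u i by (simp add: counts_eq_count_mset rot_def windows_def upd_conv_take_nth_drop)
    ultimately show ?thesis
      by (simp add: g_def power2_commute)
  qed
  have "c ^ 3 * site_energy n q (\<lambda>u. f (counts u)) i =
      (\<Sum>u\<in>windows n. c ^ 3 * path_weight p q u * g (rot u))"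
    by (simp add: site_energy_def path_mean_def g_rot sum_distrib_left mult_ac)
  also have "\<dots> \<le> (\<Sum>u\<in>windows n. path_weight p q (rot u) * g (rot u))"
  proof (intro sum_mono mult_right_mono g_nonneg)
    fix u :: "'a list"
    assume "u \<in> windows n"
    then show "c ^ 3 * path_weight p q u \<le> path_weight p q (rot u)"
      unfolding rot_def
      using path_weight_move_to_front[OF q, of "take i u" "u ! i" "drop (Suc i) u"] split by metis
  qed
  also have "\<dots> = (\<Sum>u\<in>rot ` windows n. path_weight p q u * g u)"
    by (simp add: sum.reindex[OF inj])
  also have "\<dots> \<le> (\<Sum>u\<in>windows n. path_weight p q u * g u)"
    by (intro sum_mono2 finite_windows rot_windows mult_nonneg_nonneg path_weight_nonneg q g_nonneg)
  finally have "c * (c ^ 3 * site_energy n q (\<lambda>u. f (counts u)) i) \<le> c * path_mean n q g"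
    using c_pos by (intro mult_left_mono) (simp_all add: path_mean_def)
  also have "\<dots> = path_mean n q (\<lambda>u. c * g u)"
    by (simp add: path_mean_cmult)
  \<comment> \<open>The fourth factor \<open>c\<close> is the lower bound for the probability of
    appending \<open>b\<close>.\<close>
  also have "\<dots> \<le> count_energy n q f"
    unfolding count_energy_def g_def sum_distrib_left
    by (intro path_mean_mono q sum_mono mult_right_mono c_le_p) auto
  finally show ?thesis
    by (simp add: power_numeral_reduce mult.assoc)
qed

definition "poincare_const = site_const / (1 - contraction) / c ^ 4"

lemma poincare_const_pos: "0 < poincare_const"
  unfolding poincare_const_def using site_const_pos contraction_bounds c_pos by simp

text \<open>All \<open>n\<close> site energies are bounded by the same count energy. Their number is
  the factor \<open>n\<close>, which gives the order of the lower bound on the gap.\<close>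

lemma count_poincare:
  assumes q: "minorized q"
  shows "path_var n q (\<lambda>u. f (counts u)) \<le> poincare_const * real n * count_energy n q f"
proof -
  let ?K = "site_const / (1 - contraction)"
  have "0 \<le> ?K"
    using site_const_pos contraction_bounds by simp
  have "site_energy n q (\<lambda>u. f (counts u)) i \<le> count_energy n q f / c ^ 4" if "i < n" for i
    using site_energy_counts_le[OF q that, of f] c_pos
    by (simp add: pos_le_divide_eq mult.commute)
  then have "(\<Sum>i<n. site_energy n q (\<lambda>u. f (counts u)) i) \<le> real n * (count_energy n q f / c ^ 4)"
    using sum_bounded_above[of "{..<n}" "site_energy n q (\<lambda>u. f (counts u))"
        "count_energy n q f / c ^ 4"] by simp
  then have "?K * (\<Sum>i<n. site_energy n q (\<lambda>u. f (counts u)) i) \<le>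
      ?K * (real n * (count_energy n q f / c ^ 4))"
    using \<open>0 \<le> ?K\<close> by (rule mult_left_mono)
  also have "\<dots> = poincare_const * real n * count_energy n q f"
    by (simp add: poincare_const_def)
  finally show ?thesis
    using path_poincare[OF q, of n "\<lambda>u. f (counts u)"] by linarith
qed

section \<open>Variance and Dirichlet form of the count chain as path expectations\<close>

lemma sum_count_law:
  assumes "0 < n"
  shows "(\<Sum>\<eta>\<in>count_states n. count_law p q n \<eta> * h \<eta>) = path_mean n q (\<lambda>u. h (counts u))"
proof -
  have "(\<Sum>\<eta>\<in>count_states n. count_law p q n \<eta> * h \<eta>) =
      (\<Sum>\<eta>\<in>count_states n. \<Sum>u\<in>{u \<in> windows n. counts u = \<eta>}. path_law p q u * h (counts u))"
    by (simp add: count_law_def sum_distrib_right)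
  also have "\<dots> = (\<Sum>u\<in>windows n. path_law p q u * h (counts u))"
    using counts_in_count_states by (intro sum.group finite_windows finite_count_states) auto
  also have "\<dots> = path_mean n q (\<lambda>u. h (counts u))"
    unfolding path_mean_def using assms
    by (intro sum.cong) (auto simp: windows_def path_law_eq_path_weight)
  finally show ?thesis .
qed

lemma var_on_count_law:
  assumes "0 < n"
  shows "var_on (count_states n) (count_law p q n) f = path_var n q (\<lambda>u. f (counts u))"
  by (simp add: var_on_def path_var_def sum_count_law[OF assms])

text \<open>The normalisation cancels. Where \<open>count_law\<close> vanishes the left side is
  zero, and so is every path weight on the right.\<close>

lemma count_law_times_kernel:
  assumes q: "minorized q" and n: "0 < n"
  shows "count_law p q n \<eta> * count_kernel p q n \<eta> \<xi> =
    (\<Sum>u\<in>{u \<in> windows n. counts u = \<eta>}. path_law p q u *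
       (\<Sum>z\<in>UNIV. p (last u) z * of_bool (counts (tl u @ [z]) = \<xi>)))"
    (is "_ = ?R")
proof -
  have "(\<lambda>x. \<eta> x - unit_vec (hd u) x + unit_vec z x) = counts (tl u @ [z])"
    if "u \<in> windows n" "counts u = \<eta>" for u z
    using that n counts_shift[of u z] by (auto simp: windows_def)
  then have kernel: "count_kernel p q n \<eta> \<xi> = 1 / count_law p q n \<eta> * ?R"
    unfolding count_kernel_def by simp
  show ?thesis
  proof (cases "count_law p q n \<eta> = 0")
    case True
    have "0 \<le> path_law p q u" if "u \<in> windows n" for u
      using that n path_weight_nonneg[OF q, of u]
      by (subst path_law_eq_path_weight) (auto simp: windows_def)
    with True have "\<forall>u\<in>{u \<in> windows n. counts u = \<eta>}. path_law p q u = 0"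
      unfolding count_law_def by (subst (asm) sum_nonneg_eq_0_iff) (auto simp: finite_windows)
    then have "?R = 0"
      by (intro sum.neutral) simp
    with True show ?thesis
      by simp
  qed (simp add: kernel)
qed

text \<open>The window and the appended letter determine the target \<xi>, so the sum over \<xi>
  collapses; grouping windows by their counts then gives a path expectation.\<close>

lemma dirichlet_form_count_kernel:
  assumes q: "minorized q" and n: "0 < n"
  shows "dirichlet_form (count_states n) (count_law p q n) (count_kernel p q n) f =
    count_energy n q f / 2"
proof -
  let ?S = "\<lambda>\<eta>. {u \<in> windows n. counts u = \<eta>}"
  let ?e = "\<lambda>u. \<Sum>z\<in>UNIV. p (last u) z * (f (counts (tl u @ [z])) - f (counts u))\<^sup>2"
  have "(\<Sum>\<xi>\<in>count_states n. count_law p q n \<eta> * count_kernel p q n \<eta> \<xi> * (f \<xi> - f \<eta>)\<^sup>2) =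
      (\<Sum>u\<in>?S \<eta>. path_law p q u * ?e u)" for \<eta>
  proof -
    have "(\<Sum>\<xi>\<in>count_states n. count_law p q n \<eta> * count_kernel p q n \<eta> \<xi> * (f \<xi> - f \<eta>)\<^sup>2) =
        (\<Sum>\<xi>\<in>count_states n. \<Sum>u\<in>?S \<eta>. \<Sum>z\<in>UNIV. path_law p q u * p (last u) z *
          (of_bool (counts (tl u @ [z]) = \<xi>) * (f \<xi> - f \<eta>)\<^sup>2))"
      by (simp only: count_law_times_kernel[OF q n] sum_distrib_right sum_distrib_left mult.assoc)
    also have "\<dots> = (\<Sum>u\<in>?S \<eta>. \<Sum>z\<in>UNIV. path_law p q u * p (last u) z *
        (\<Sum>\<xi>\<in>count_states n. of_bool (counts (tl u @ [z]) = \<xi>) * (f \<xi> - f \<eta>)\<^sup>2))"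
      unfolding sum_distrib_left
      by (subst sum.swap) (intro sum.cong refl, rule sum.swap)
    also have "\<dots> = (\<Sum>u\<in>?S \<eta>. \<Sum>z\<in>UNIV. path_law p q u * p (last u) z *
        (f (counts (tl u @ [z])) - f \<eta>)\<^sup>2)"
    proof (intro sum.cong refl arg_cong2[of _ _ _ _ "(*)"])
      fix u z
      assume "u \<in> ?S \<eta>"
      then have "counts (tl u @ [z]) \<in> count_states n"
        using n by (intro counts_in_count_states) (auto simp: windows_def)
      then show "(\<Sum>\<xi>\<in>count_states n. of_bool (counts (tl u @ [z]) = \<xi>) * (f \<xi> - f \<eta>)\<^sup>2) =
          (f (counts (tl u @ [z])) - f \<eta>)\<^sup>2"
        by (simp add: of_bool_def if_distrib if_distribR finite_count_states cong: if_cong)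
    qed
    also have "\<dots> = (\<Sum>u\<in>?S \<eta>. path_law p q u * ?e u)"
      by (simp add: sum_distrib_left mult.assoc)
    finally show ?thesis .
  qed
  then have "dirichlet_form (count_states n) (count_law p q n) (count_kernel p q n) f =
      1 / 2 * (\<Sum>\<eta>\<in>count_states n. \<Sum>u\<in>?S \<eta>. path_law p q u * ?e u)"
    by (simp add: dirichlet_form_def)
  also have "(\<Sum>\<eta>\<in>count_states n. \<Sum>u\<in>?S \<eta>. path_law p q u * ?e u) =
      (\<Sum>u\<in>windows n. path_law p q u * ?e u)"
    using counts_in_count_states by (intro sum.group finite_windows finite_count_states) auto
  also have "\<dots> = count_energy n q f"
    unfolding path_mean_def count_energy_def using n
    by (intro sum.cong) (auto simp: windows_def path_law_eq_path_weight)
  finally show ?thesis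
    by simp
qed

section \<open>The variance of a single count\<close>

text \<open>If \<open>\<psi>\<close> is nearly constant, then so is its image under \<open>p\<close>, and \<open>\<phi>\<close> is not. Hence two
  consecutive steps always contribute to the variance.\<close>

lemma two_step_variance:
  fixes \<psi> m :: "'a \<Rightarrow> real"
  assumes q: "minorized q" and "a \<noteq> b"
  defines "\<phi> \<equiv> \<lambda>z. of_bool (z = a) + (\<Sum>y\<in>UNIV. p z y * \<psi> y)"
  shows "c / 8 \<le> (\<Sum>z\<in>UNIV. q z * (\<Sum>y\<in>UNIV. p z y * (\<psi> y - m z)\<^sup>2)) +
    (\<Sum>z\<in>UNIV. q z * (\<phi> z - k)\<^sup>2)"
proof -
  define W where "W = (\<Sum>z\<in>UNIV. q z * (\<phi> z - k)\<^sup>2)"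
  have W: "c * ((\<phi> a - k)\<^sup>2 + (\<phi> b - k)\<^sup>2) \<le> W"
  proof -
    have "c * ((\<phi> a - k)\<^sup>2 + (\<phi> b - k)\<^sup>2) = (\<Sum>z\<in>{a, b}. c * (\<phi> z - k)\<^sup>2)"
      using \<open>a \<noteq> b\<close> by (simp add: distrib_left)
    also have "\<dots> \<le> (\<Sum>z\<in>UNIV. c * (\<phi> z - k)\<^sup>2)"
      using c_pos by (intro sum_mono2) auto
    also have "\<dots> \<le> W"
      unfolding W_def by (intro sum_mono mult_right_mono minorized_ge q) auto
    finally show ?thesis .
  qed
  have "c - 4 * W \<le> 8 * (\<Sum>y\<in>UNIV. p z y * (\<psi> y - m z)\<^sup>2)" for z
  proof -
    define A where "A = (\<Sum>y\<in>UNIV. (\<psi> y - m z)\<^sup>2)"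
    define \<alpha> where "\<alpha> x = (\<Sum>y\<in>UNIV. p x y * (\<psi> y - m z))" for x
    have A: "c * A \<le> (\<Sum>y\<in>UNIV. p z y * (\<psi> y - m z)\<^sup>2)"
      unfolding A_def sum_distrib_left by (intro sum_mono mult_right_mono c_le_p) auto
    have \<alpha>: "(\<alpha> x)\<^sup>2 \<le> A" for x
    proof -
      have "(\<alpha> x)\<^sup>2 \<le> (\<Sum>y\<in>UNIV. p x y) * (\<Sum>y\<in>UNIV. p x y * (\<psi> y - m z)\<^sup>2)"
        unfolding \<alpha>_def by (intro weighted_square_le p_nonneg)
      also have "\<dots> \<le> A"
        unfolding A_def sum_p
        using minorized_le_1[OF minorized_p, of x]
        by (auto intro!: sum_mono mult_left_le_one_le p_nonneg)
      finally show ?thesis .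
    qed
    have \<alpha>_eq: "\<alpha> x = (\<Sum>y\<in>UNIV. p x y * \<psi> y) - m z" for x
      by (simp add: \<alpha>_def right_diff_distrib sum_subtractf sum_p flip: sum_distrib_right)
    define s t where "s = \<phi> a - k" and "t = \<phi> b - k"
    \<comment> \<open>The indicator in \<phi> jumps by one between \<open>a\<close> and
      \<open>b\<close>, and the centres \<open>k\<close> and \<open>m z\<close> cancel.\<close>
    have "s - t - \<alpha> a + \<alpha> b = 1"
      using \<open>a \<noteq> b\<close> by (simp add: \<phi>_def \<alpha>_eq s_def t_def)
    moreover have "(s - t - \<alpha> a + \<alpha> b)\<^sup>2 \<le> 4 * (s\<^sup>2 + t\<^sup>2 + (\<alpha> a)\<^sup>2 + (\<alpha> b)\<^sup>2)"
    proof -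
      \<comment> \<open>The squared pairwise differences of the four summands \<open>s\<close>,
        \<open>-t\<close>, \<open>-\<alpha> a\<close>, \<open>\<alpha> b\<close> add up to the gap
        between the two sides.\<close>
      have "0 \<le> (s + t)\<^sup>2 + (s + \<alpha> a)\<^sup>2 + (s - \<alpha> b)\<^sup>2 + (t - \<alpha> a)\<^sup>2 + (t + \<alpha> b)\<^sup>2 + (\<alpha> a + \<alpha> b)\<^sup>2"
        by simp
      then show ?thesis
        by (simp add: power2_eq_square algebra_simps)
    qed
    ultimately have "1 \<le> 4 * (s\<^sup>2 + t\<^sup>2) + 8 * A"
      using \<alpha>[of a] \<alpha>[of b] by simp
    then have "c * 1 \<le> c * (4 * (s\<^sup>2 + t\<^sup>2) + 8 * A)"
      using c_pos by (intro mult_left_mono) auto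
    then show ?thesis
      using A W by (simp add: s_def t_def distrib_left)
  qed
  then have "(\<Sum>z\<in>UNIV. q z * (c - 4 * W)) \<le>
      (\<Sum>z\<in>UNIV. q z * (8 * (\<Sum>y\<in>UNIV. p z y * (\<psi> y - m z)\<^sup>2)))"
    by (intro sum_mono mult_left_mono minorized_nonneg q)
  also have "\<dots> = 8 * (\<Sum>z\<in>UNIV. q z * (\<Sum>y\<in>UNIV. p z y * (\<psi> y - m z)\<^sup>2))"
    by (simp add: sum_distrib_left mult_ac)
  finally have "c - 4 * W \<le> 8 * (\<Sum>z\<in>UNIV. q z * (\<Sum>y\<in>UNIV. p z y * (\<psi> y - m z)\<^sup>2))"
    unfolding sum_distrib_right[symmetric] minorized_sum[OF q] by simp
  moreover have "0 \<le> W"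
    unfolding W_def by (simp add: sum_nonneg minorized_nonneg[OF q])
  ultimately show ?thesis
    by (simp add: W_def)
qed

text \<open>Total variance is applied to two letters at a time, and each pair contributes at least
  \<open>c / 8\<close>. A single remaining letter contributes a nonnegative variance.\<close>

lemma path_var_count_ge:
  assumes "a \<noteq> b" "minorized q"
  shows "c / 8 * real (n div 2) \<le> path_var n q (\<lambda>u. real (counts u a))"
  using assms(2)
proof (induction n arbitrary: q rule: induct_nat_012)
  case (ge2 n)
  let ?F = "\<lambda>u. real (counts u a)"
  \<comment> \<open>The conditional mean of the count of \<open>a\<close> in a path of
    \<open>m + 1\<close> letters that starts at \<open>z\<close>.\<close>
  define \<psi> where "\<psi> m z = of_bool (z = a) + path_mean m (p z) ?F" for m z
  have F_Cons: "?F (z # u) = of_bool (z = a) + ?F u" for z u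
    by (auto simp: counts_eq_count_mset)
  have mean: "path_mean m (p z) (\<lambda>u. ?F (z # u)) = \<psi> m z" for m z
    by (simp add: F_Cons path_mean_add \<psi>_def)
  have var: "path_var (Suc m) r ?F = (\<Sum>z\<in>UNIV. r z * path_var m (p z) ?F) +
      (\<Sum>z\<in>UNIV. r z * (\<psi> m z - (\<Sum>y\<in>UNIV. r y * \<psi> m y))\<^sup>2)"
    if "minorized r" for m r
    unfolding path_var_Suc[OF that] mean by (simp add: F_Cons path_var_add_const)
  have \<psi>_Suc: "\<psi> (Suc m) z = of_bool (z = a) + (\<Sum>y\<in>UNIV. p z y * \<psi> m y)" for m z
    by (simp add: \<psi>_def[of "Suc m"] path_mean_Suc mean)
  let ?V = "\<lambda>z. \<Sum>y\<in>UNIV. p z y * (\<psi> n y - (\<Sum>y\<in>UNIV. p z y * \<psi> n y))\<^sup>2"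
  have "c / 8 * real (n div 2) + ?V z \<le> path_var (Suc n) (p z) ?F" for z
  proof -
    have "(\<Sum>y\<in>UNIV. p z y * (c / 8 * real (n div 2))) \<le>
        (\<Sum>y\<in>UNIV. p z y * path_var n (p y) ?F)"
      by (intro sum_mono mult_left_mono ge2.IH p_nonneg) simp
    then have "c / 8 * real (n div 2) \<le> (\<Sum>y\<in>UNIV. p z y * path_var n (p y) ?F)"
      unfolding sum_distrib_right[symmetric] sum_p by simp
    then show ?thesis
      unfolding var[OF minorized_p] by simp
  qed
  then have "(\<Sum>z\<in>UNIV. q z * (c / 8 * real (n div 2) + ?V z)) \<le>
      (\<Sum>z\<in>UNIV. q z * path_var (Suc n) (p z) ?F)"
    by (intro sum_mono mult_left_mono minorized_nonneg ge2.prems)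
  moreover have "(\<Sum>z\<in>UNIV. q z * (c / 8 * real (n div 2) + ?V z)) =
      c / 8 * real (n div 2) + (\<Sum>z\<in>UNIV. q z * ?V z)"
    unfolding distrib_left sum.distrib sum_distrib_right[symmetric] minorized_sum[OF ge2.prems]
    by simp
  \<comment> \<open>The centres \<open>m z\<close> and \<open>k\<close> are the mean of
    \<open>\<psi> n\<close> under \<open>p z\<close> and that of \<open>\<psi> (Suc n)\<close> under
    \<open>q\<close>.\<close>
  moreover have "c / 8 \<le> (\<Sum>z\<in>UNIV. q z * ?V z) +
      (\<Sum>z\<in>UNIV. q z * (\<psi> (Suc n) z - (\<Sum>y\<in>UNIV. q y * \<psi> (Suc n) y))\<^sup>2)"
    unfolding \<psi>_Suc by (rule two_step_variance[OF ge2.prems \<open>a \<noteq> b\<close>])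
  ultimately show ?case
    unfolding var[OF ge2.prems] by (simp add: distrib_left)
qed (auto simp: path_var_nonneg)

lemma count_energy_count_le:
  assumes q: "minorized q" and n: "0 < n"
  shows "count_energy n q (\<lambda>\<eta>. real (\<eta> a)) \<le> 1"
proof -
  have "count_energy n q (\<lambda>\<eta>. real (\<eta> a)) \<le> path_mean n q (\<lambda>_. 1)"
    unfolding count_energy_def
  proof (intro path_mean_mono q)
    fix u :: "'a list"
    assume "u \<in> windows n"
    then obtain x v where u: "u = x # v"
      using n by (cases u) (auto simp: windows_def)
    have "(\<Sum>z\<in>UNIV. p (last u) z * (real (counts (tl u @ [z]) a) - real (counts u a))\<^sup>2) \<le>
        (\<Sum>z\<in>UNIV. p (last u) z * 1)"
      by (intro sum_mono mult_left_mono p_nonneg) (auto simp: u counts_eq_count_mset)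
    then show "(\<Sum>z\<in>UNIV. p (last u) z * (real (counts (tl u @ [z]) a) - real (counts u a))\<^sup>2) \<le> 1"
      by (simp add: sum_p)
  qed
  then show ?thesis
    using q by simp
qed

section \<open>The two-sided bound on the gap\<close>

lemma count_energy_nonneg: "minorized q \<Longrightarrow> 0 \<le> count_energy n q f"
  unfolding count_energy_def
  by (intro path_mean_nonneg sum_nonneg mult_nonneg_nonneg p_nonneg) auto

lemma count_gap_bounds:
  assumes q: "minorized q" and card: "2 \<le> CARD('a)" and n: "2 \<le> n"
  shows "1 / (2 * poincare_const) / real n \<le> count_gap p q n"
    and "count_gap p q n \<le> 12 / c / real n"
proof -
  have "0 < n"
    using n by simp
  obtain a b :: 'a where "a \<noteq> b"
    using card by (metis (full_types) card_2_iff' card_le_Suc0_iff_eq finite not_less_eq_eq numeral_2_eq_2 UNIV_I)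
  let ?V = "\<lambda>f. path_var n q (\<lambda>u. f (counts u))"
  define Q where "Q = {count_energy n q f / 2 / ?V f | f. ?V f > 0}"
  have gap: "count_gap p q n = Inf Q"
    by (simp add: count_gap_def spectral_gap_def Q_def var_on_count_law[OF \<open>0 < n\<close>]
        dirichlet_form_count_kernel[OF q \<open>0 < n\<close>])
  let ?f = "\<lambda>\<eta>. real (\<eta> a)"
  \<comment> \<open>Needs \<open>2 \<le> n\<close>, with equality at 3. The constant 24 is this 3
    times the 8 of the variance bound; the Dirichlet form, at most 1/2, turns it into 12.\<close>
  have "n \<le> 3 * (n div 2)"
    using n by presburger
  then have "real n \<le> 3 * real (n div 2)"
    by linarith
  then have "c / 8 * (real n / 3) \<le> c / 8 * real (n div 2)"
    using c_pos by (intro mult_left_mono) auto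
  also have "\<dots> \<le> ?V ?f"
    by (rule path_var_count_ge[OF \<open>a \<noteq> b\<close> q])
  finally have var_ge: "c * real n / 24 \<le> ?V ?f"
    by simp
  have cn: "0 < c * real n / 24"
    using c_pos \<open>0 < n\<close> by simp
  \<comment> \<open>The test function shows that \<open>Q\<close> is nonempty, which the lower bound
    on the real infimum requires.\<close>
  have mem: "count_energy n q ?f / 2 / ?V ?f \<in> Q"
    unfolding Q_def using cn var_ge by (auto intro!: exI[of _ ?f])
  have lower: "1 / (2 * poincare_const) / real n \<le> x" if x_in: "x \<in> Q" for x
  proof -
    obtain f where x: "x = count_energy n q f / 2 / ?V f" and V: "?V f > 0"
      using x_in by (auto simp: Q_def)
    show ?thesis
      unfolding x using V count_poincare[OF q, of n f] poincare_const_pos \<open>0 < n\<close>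
      by (simp add: field_simps)
  qed
  show "1 / (2 * poincare_const) / real n \<le> count_gap p q n"
    unfolding gap using mem lower by (intro cInf_greatest) auto
  have "Inf Q \<le> count_energy n q ?f / 2 / ?V ?f"
    using mem lower by (intro cInf_lower bdd_belowI)
  also have "\<dots> \<le> 1 / 2 / (c * real n / 24)"
    using count_energy_count_le[OF q \<open>0 < n\<close>, of a] count_energy_nonneg[OF q, of n ?f] var_ge cn
    by (intro frac_le) auto
  finally show "count_gap p q n \<le> 12 / c / real n"
    unfolding gap by simp
qed

end

theorem corollary9p1:
  fixes p :: "'a::finite \<Rightarrow> 'a \<Rightarrow> real" and \<pi> :: "'a \<Rightarrow> real"
  assumes "CARD('a) \<ge> 2"
    and "markov_kernel p"
    and "stationary p \<pi>"
    and "reversible p \<pi>"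
    and "p_star p > 0"
  shows "(\<exists>c_minus c_plus :: real. 0 < c_minus \<and> c_minus \<le> c_plus \<and>
            (\<forall>n::nat. n \<ge> 2 \<longrightarrow>
               c_minus / real n \<le> count_gap p \<pi> n \<and> count_gap p \<pi> n \<le> c_plus / real n))
         \<and> (\<lambda>n::nat. count_gap p \<pi> n) \<in> \<Theta>(\<lambda>n. 1 / real n)"
proof -
  interpret positive_kernel p "p_star p"
    using assms(2,5) by unfold_locales (auto simp: p_star_le markov_kernel_def)
  \<comment> \<open>By stationarity \<open>\<pi> y\<close> is an average of the entries
    \<open>p x y\<close>, so \<pi> inherits their lower bound.\<close>
  have "p_star p \<le> \<pi> y" for y
  proof -
    have "p_star p = (\<Sum>x\<in>UNIV. \<pi> x * p_star p)"
      using assms(3) by (simp add: stationary_def flip: sum_distrib_right)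
    also have "\<dots> \<le> (\<Sum>x\<in>UNIV. \<pi> x * p x y)"
      using assms(3) by (intro sum_mono mult_left_mono p_star_le) (auto simp: stationary_def)
    finally show ?thesis
      using assms(3) by (simp add: stationary_def)
  qed
  then have \<pi>: "minorized \<pi>"
    using assms(3) by (simp add: minorized_def stationary_def)
  define c1 c2 where "c1 = 1 / (2 * poincare_const)" and "c2 = 12 / p_star p"
  have c1: "0 < c1"
    using poincare_const_pos by (simp add: c1_def)
  have bounds: "c1 / real n \<le> count_gap p \<pi> n" "count_gap p \<pi> n \<le> c2 / real n" if "2 \<le> n" for n
    unfolding c1_def c2_def using count_gap_bounds[OF \<pi> assms(1) that] by auto
  \<comment> \<open>Both bounds hold for the same gap at window length 2.\<close>
  have "c1 \<le> c2"
    using bounds[of 2] by simp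
  have "(\<lambda>n. count_gap p \<pi> n) \<in> O(\<lambda>n. 1 / real n)"
  proof (rule bigoI)
    show "\<forall>\<^sub>F n in sequentially. norm (count_gap p \<pi> n) \<le> c2 * norm (1 / real n)"
      using eventually_ge_at_top[of 2]
    proof eventually_elim
      case (elim n)
      have "0 \<le> c1 / real n"
        using c1 by simp
      with bounds[OF elim] show ?case
        by simp
    qed
  qed
  moreover have "(\<lambda>n. count_gap p \<pi> n) \<in> \<Omega>(\<lambda>n. 1 / real n)"
  proof (rule landau_omega.bigI[OF c1])
    show "\<forall>\<^sub>F n in sequentially. c1 * norm (1 / real n) \<le> norm (count_gap p \<pi> n)"
      using eventually_ge_at_top[of 2]
    proof eventually_elim
      case (elim n)
      then show ?case
        using bounds(1)[OF elim] by simp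
    qed
  qed
  ultimately have "(\<lambda>n. count_gap p \<pi> n) \<in> \<Theta>(\<lambda>n. 1 / real n)"
    by (rule bigthetaI)
  with c1 \<open>c1 \<le> c2\<close> bounds show ?thesis
    by blast
qed

end
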